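(* Let $G=G_1+G_2+\cdots+G_l$ be a simple graph where each $G_i=(T_1^i(w_1^i),\dots,T_{m_i}^i(w_{m_i}^i))$ with each $T_j^i$ a tree. Let $D=D_1+\cdots+D_l$ be an oriented graph obtained from $G$ by choosing a strong orientation of each of its cycles (and any orientation of the other edges), with $\mathrm{und}(D_i)=G_i$; denote by $C_{m_i}^+$ the cycle of $D_i$, with vertices $a_1^i,\dots,a_{m_i}^i$ (where $a_j^i$ is identified with $w_j^i$) and arcs $(a_j^i,a_{j+1}^i)$, $(a_{m_i}^i,a_1^i)$. Let $\Gamma$ be a family of 1-regular digraphs all with the same vertex set $V$, let $h:E(D)\to\Gamma$ be any function, and let $h_i^\xi=h|_{E(C_{m_i}^+)}$. For each $i$ let $P_{h_i^\xi}=h(a_{m_i}^ia_1^i)\cdots h(a_2^ia_3^i)\cdot h(a_1^ia_2^i)$ (composition of permutations, $h(a_1^ia_2^i)$ applied first), with disjoint cyclic decomposition $\sigma_1^i\cdots\sigma_{s_i}^i$ (including cycles of length $1$), and let $|\sigma_j^i|$ be the length of $\sigma_j^i$. Then $$\mathrm{und}(D\otimes_h\Gamma)\cong\sum_{i=1}^l\sum_{j=1}^{s_i}\big(T_1^i(w_1^i),T_2^i(w_2^i),\dots,T_{m_i}^i(w_{m_i}^i)\big)^{|\sigma_j^i|}.$$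
   Context: Notation: for trees $T_1,\dots,T_m$ (each of order $\ge1$) and $w_j\in V(T_j)$, $(T_1(w_1),\dots,T_m(w_m))$ is the unicyclic graph obtained from a cycle $a_1\cdots a_m$ and disjoint copies of the $T_j$ by identifying $w_j$ with $a_j$; $(T_1(w_1),\dots,T_m(w_m))^k$ is the same construction with the sequence of $m$ entries repeated $k$ times (cycle length $mk$). Sums denote disjoint unions. A 1-regular digraph on $V$ (all in-/out-degrees $1$) is identified with the permutation $\pi$ with $\pi(x)=y$ iff $(x,y)$ is an arc. Product: for a digraph $D$, a family $\Gamma$ of digraphs with common vertex set $V$ and $h:E(D)\to\Gamma$, $D\otimes_h\Gamma$ has vertex set $V(D)\times V$ and $((a,x),(b,y))$ is an arc iff $(a,b)\in E(D)$ and $(x,y)\in E(h(a,b))$. $\mathrm{und}$ is underlying graph. *)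

theory Defs
  imports "Graph_Theory.Graph_Theory" "HOL-Combinatorics.Cycles"
begin

text \<open>
  Digraphs without parallel arcs are values of type \<^typ>\<open>'a pair_pre_digraph\<close>; loops are allowed.
  As in \<^theory>\<open>Graph_Theory.Digraph\<close>, a (finite simple undirected) graph is a symmetric digraph,
  \<^const>\<open>pair_graph\<close>, each edge being represented by its two arcs. Accordingly the underlying
  graph of a digraph is \<^const>\<open>mk_symmetric\<close>, and graphs are isomorphic iff they are related
  by \<^const>\<open>digraph_iso\<close>.
\<close>

abbreviation und :: "'a pair_pre_digraph \<Rightarrow> 'a pair_pre_digraph" where
  "und D \<equiv> mk_symmetric (with_proj D)"

abbreviation graph_iso :: "'a pair_pre_digraph \<Rightarrow> 'b pair_pre_digraph \<Rightarrow> bool"  (infix \<open>\<cong>\<^sub>g\<close> 50) where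
  "G \<cong>\<^sub>g H \<equiv> digraph_iso (with_proj G) (with_proj H)"

text \<open>
  The library's \<^const>\<open>tree\<close> cannot be used for undirected graphs: in a symmetric digraph every edge
  \<open>{a, b}\<close> yields the directed cycle \<open>a, b, a\<close>. The cycles of a simple graph are
  the directed cycles of length at least 3. Connectedness includes that the vertex set is nonempty.
\<close>

definition tree_graph :: "'a pair_pre_digraph \<Rightarrow> bool" where
  "tree_graph T \<longleftrightarrow> pair_graph T \<and> Digraph_Component.connected (with_proj T) \<and>
     \<not> (\<exists>p. pre_digraph.cycle (with_proj T) p \<and> 3 \<le> length p)"

definition disjoint_sum :: "'i set \<Rightarrow> ('i \<Rightarrow> 'a pair_pre_digraph) \<Rightarrow> ('i \<times> 'a) pair_pre_digraph" where
  "disjoint_sum I F = \<lparr> pverts = (SIGMA i:I. pverts (F i)),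
     parcs = {((i, u), (i, v)) | i u v. i \<in> I \<and> (u, v) \<in> parcs (F i)} \<rparr>"

text \<open>
  A sequence \<open>T\<^sub>1(w\<^sub>1), \<dots>, T\<^sub>m(w\<^sub>m)\<close> is a list of pairs \<open>(T\<^sub>j, w\<^sub>j)\<close>, with positions counted
  from 0. The copy of \<open>T\<^sub>j\<close> at position \<open>j\<close> is tagged with \<open>j\<close>; the cycle vertex \<open>a\<^sub>j\<close> is identified
  with \<open>w\<^sub>j\<close> by taking \<open>(j, w\<^sub>j)\<close> for it.
\<close>

type_synonym 'a rooted_tree = "'a pair_pre_digraph \<times> 'a"

definition cycle_vertex :: "'a rooted_tree list \<Rightarrow> nat \<Rightarrow> nat \<times> 'a" where
  "cycle_vertex ts j = (j, snd (ts ! j))"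

definition cycle_arc :: "'a rooted_tree list \<Rightarrow> nat \<Rightarrow> (nat \<times> 'a) \<times> (nat \<times> 'a)" where
  "cycle_arc ts j = (cycle_vertex ts j, cycle_vertex ts (Suc j mod length ts))"

definition cycle_arcs :: "'a rooted_tree list \<Rightarrow> ((nat \<times> 'a) \<times> (nat \<times> 'a)) list" where
  "cycle_arcs ts = map (cycle_arc ts) [0..<length ts]"

definition unicyclic :: "'a rooted_tree list \<Rightarrow> (nat \<times> 'a) pair_pre_digraph" where
  "unicyclic ts =
    (let F = disjoint_sum {..<length ts} (\<lambda>j. fst (ts ! j))
     in \<lparr> pverts = pverts F,
          parcs = parcs F \<union> set (cycle_arcs ts) \<union> (set (cycle_arcs ts))\<inverse> \<rparr>)"

definition unicyclic_power :: "'a rooted_tree list \<Rightarrow> nat \<Rightarrow> (nat \<times> 'a) pair_pre_digraph" where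
  "unicyclic_power ts k = unicyclic (concat (replicate k ts))"

definition orientation_of :: "'a pair_pre_digraph \<Rightarrow> 'a pair_pre_digraph \<Rightarrow> bool" where
  "orientation_of D G \<longleftrightarrow> pair_wf_digraph D \<and> asym (parcs D) \<and> und D = G"

definition one_regular :: "'v pair_pre_digraph \<Rightarrow> bool" where
  "one_regular F \<longleftrightarrow> pair_fin_digraph F \<and>
     (\<forall>x\<in>pverts F. in_degree (with_proj F) x = 1 \<and> out_degree (with_proj F) x = 1)"

text \<open>
  The permutation identified with a 1-regular digraph, extended by the identity outside the
  vertex set, which is the convention of \<^const>\<open>permutes\<close>.
\<close>

definition digraph_perm :: "'v pair_pre_digraph \<Rightarrow> 'v \<Rightarrow> 'v" where
  "digraph_perm F x = (if x \<in> pverts F then THE y. (x, y) \<in> parcs F else x)"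

text \<open>
  The product \<open>D \<otimes>\<^sub>h \<Gamma>\<close>. The family \<open>\<Gamma>\<close> enters only through its common vertex set \<open>V\<close>
  and through \<open>h\<close>.
\<close>

definition product_h ::
    "'a pair_pre_digraph \<Rightarrow> ('a \<times> 'a \<Rightarrow> 'v pair_pre_digraph) \<Rightarrow> 'v set \<Rightarrow> ('a \<times> 'v) pair_pre_digraph" where
  "product_h D h V = \<lparr> pverts = pverts D \<times> V,
     parcs = {((a, x), (b, y)) | a x b y. (a, b) \<in> parcs D \<and> (x, y) \<in> parcs (h (a, b))} \<rparr>"

text \<open>
  For \<open>es = [e\<^sub>1, \<dots>, e\<^sub>m]\<close> this is \<open>h(e\<^sub>m) \<circ> \<dots> \<circ> h(e\<^sub>1)\<close>, so that \<open>h(e\<^sub>1)\<close> is applied first.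
\<close>

definition composed_perm :: "('e \<Rightarrow> 'v pair_pre_digraph) \<Rightarrow> 'e list \<Rightarrow> 'v \<Rightarrow> 'v" where
  "composed_perm h es = fold (\<lambda>e p. digraph_perm (h e) \<circ> p) es id"

text \<open>
  The list \<open>\<sigma>s\<close> holds the disjoint cycles of \<open>p\<close> on \<open>V\<close>, each written as a list of its elements.
  The cycles cover \<open>V\<close>, so fixed points occur as cycles of length 1.
\<close>

definition cycle_decomposition_of :: "'v set \<Rightarrow> ('v \<Rightarrow> 'v) \<Rightarrow> 'v list list \<Rightarrow> bool" where
  "cycle_decomposition_of V p \<sigma>s \<longleftrightarrow>
     [] \<notin> set \<sigma>s \<and> distinct (concat \<sigma>s) \<and> set (concat \<sigma>s) = V \<and>
     p = foldr (\<lambda>\<sigma> q. cycle_of_list \<sigma> \<circ> q) \<sigma>s id"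

end

theory Submission
  imports Defs
begin

text \<open>
  The underlying graph of the product is the permutation voltage cover of the underlying graph of
  the oriented factor: crossing an edge along its orientation applies the permutation of its arc,
  crossing it backwards the inverse. On a tree such a voltage assignment has a potential, a family
  of permutations \<open>\<theta>\<close> on the vertices with \<open>\<theta> v = g u v \<circ> \<theta> u\<close> on edges. Cutting the cycle at its last
  arc, the potential trivialises the cover over the whole component except over that arc, where the
  sheets are permuted by the composed permutation of the cycle. Each cycle \<open>\<tau>\<close> of it therefore glues
  \<open>length \<tau>\<close> sheets cyclically into one unicyclic graph.
\<close>

section \<open>Isomorphisms given by vertex maps\<close>

text \<open>Without parallel arcs a vertex map determines the arc map, so working with
  \<open>f\<close> alone avoids the record of four functions behind
  \<open>digraph_iso\<close>.\<close>

definition iso_map :: "('a \<Rightarrow> 'b) \<Rightarrow> 'a pair_pre_digraph \<Rightarrow> 'b pair_pre_digraph \<Rightarrow> bool" where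
  "iso_map f G H \<longleftrightarrow> bij_betw f (pverts G) (pverts H) \<and> map_prod f f ` parcs G = parcs H"

lemma iso_map_imp_graph_iso:
  assumes "pair_wf_digraph G" "iso_map f G H"
  shows "G \<cong>\<^sub>g H"
proof -
  interpret pair_wf_digraph G by fact
  let ?hom = "\<lparr>iso_verts = f, iso_arcs = map_prod f f, iso_head = snd, iso_tail = fst\<rparr>"
  have inj: "inj_on f (pverts G)" and f: "f ` pverts G = pverts H" "map_prod f f ` parcs G = parcs H"
    using assms(2) by (auto simp: iso_map_def bij_betw_def)
  have "parcs G \<subseteq> pverts G \<times> pverts G"
    using in_arcsD1 in_arcsD2 by auto
  then have "inj_on (map_prod f f) (parcs G)"
    using map_prod_inj_on[OF inj inj] inj_on_subset by blast
  then have "pre_digraph.digraph_isomorphism (with_proj G) ?hom"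
    using inj wf_digraph_axioms by (simp add: pre_digraph.digraph_isomorphism_def)
  moreover have "with_proj H = app_iso ?hom (with_proj G)"
    using f by (simp add: app_iso_def with_proj_def)
  ultimately show ?thesis
    unfolding digraph_iso_def by blast
qed

text \<open>The vertex map constructed later runs from the sum of powers to the product, since
  positions in the powers have explicit images; the theorem asks for the opposite direction.\<close>

lemma iso_map_inverse:
  assumes "pair_wf_digraph G" "iso_map f G H"
  shows "iso_map (the_inv_into (pverts G) f) H G"
proof -
  interpret pair_wf_digraph G by fact
  let ?g = "the_inv_into (pverts G) f"
  have bij: "bij_betw f (pverts G) (pverts H)" and H: "parcs H = map_prod f f ` parcs G"
    using assms(2) by (auto simp: iso_map_def)
  have gf: "?g (f u) = u" if "u \<in> pverts G" for u
    using that bij by (simp add: bij_betw_def the_inv_into_f_f)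
  have "map_prod ?g ?g (map_prod f f e) = e" if "e \<in> parcs G" for e
    using that in_arcsD1 in_arcsD2 gf by (cases e) auto
  then have "map_prod ?g ?g ` parcs H = parcs G"
    unfolding H image_image by simp
  with bij show ?thesis
    by (simp add: iso_map_def bij_betw_the_inv_into)
qed

text \<open>This carries well-formedness over to the product, where
  \<open>iso_map_imp_graph_iso\<close> needs it for the inverted map.\<close>

lemma iso_map_wf:
  assumes "pair_wf_digraph G" "iso_map f G H"
  shows "pair_wf_digraph H"
proof -
  interpret pair_wf_digraph G by fact
  have "pverts H = f ` pverts G" "parcs H = map_prod f f ` parcs G"
    using assms(2) by (auto simp: iso_map_def bij_betw_def)
  then show ?thesis
    by unfold_locales (auto dest: in_arcsD1 in_arcsD2)
qed

section \<open>Underlying graphs, disjoint sums and products\<close>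

lemma parcs_und: "parcs (und D) = parcs D \<union> (parcs D)\<inverse>"
  by (auto simp: parcs_mk_symmetric)

lemma pverts_disjoint_sum: "pverts (disjoint_sum I F) = (SIGMA i:I. pverts (F i))"
  by (simp add: disjoint_sum_def)

lemma parcs_disjoint_sum:
  "parcs (disjoint_sum I F) = {((i, u), (i, v)) | i u v. i \<in> I \<and> (u, v) \<in> parcs (F i)}"
  by (simp add: disjoint_sum_def)

lemma disjoint_sum_wf:
  assumes "\<And>i. i \<in> I \<Longrightarrow> pair_wf_digraph (F i)"
  shows "pair_wf_digraph (disjoint_sum I F)"
  using pair_wf_digraph.in_arcsD1[OF assms] pair_wf_digraph.in_arcsD2[OF assms]
  by unfold_locales (auto simp: pverts_disjoint_sum parcs_disjoint_sum)

lemma und_product_arc_iff: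
  "((a, x), (b, y)) \<in> parcs (und (product_h D h V)) \<longleftrightarrow>
    (a, b) \<in> parcs D \<and> (x, y) \<in> parcs (h (a, b)) \<or> (b, a) \<in> parcs D \<and> (y, x) \<in> parcs (h (b, a))"
  by (auto simp: parcs_und product_h_def)

text \<open>No arc of a disjoint sum joins two summands, so \<open>product_h\<close> can be treated
  summand by summand. All that remains is to move the tag \<open>i\<close> from the outer pair
  \<open>(i, (a, x))\<close> into the first component, \<open>((i, a), x)\<close>.\<close>

lemma iso_map_disjoint_sum_product:
  fixes D :: "'i \<Rightarrow> 'a pair_pre_digraph" and h :: "('i \<times> 'a) \<times> ('i \<times> 'a) \<Rightarrow> 'v pair_pre_digraph"
  assumes "\<And>i. i \<in> I \<Longrightarrow>
    iso_map (f i) (F i) (und (product_h (D i) (\<lambda>(u, v). h ((i, u), (i, v))) V))"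
  shows "iso_map (\<lambda>(i, x). ((i, fst (f i x)), snd (f i x)))
    (disjoint_sum I F) (und (product_h (disjoint_sum I D) h V))"
    (is "iso_map ?f ?S ?P")
proof -
  let ?Q = "\<lambda>i. und (product_h (D i) (\<lambda>(u, v). h ((i, u), (i, v))) V)"
  let ?t = "\<lambda>i (a, x). ((i, a), x)"
  have bij: "bij_betw (f i) (pverts (F i)) (pverts (?Q i))"
    and arcs: "map_prod (f i) (f i) ` parcs (F i) = parcs (?Q i)" if "i \<in> I" for i
    using assms[OF that] by (auto simp: iso_map_def)
  have inj: "inj_on ?f (pverts ?S)"
  proof (rule inj_onI, clarsimp simp: pverts_disjoint_sum)
    fix i u v
    assume "i \<in> I" "u \<in> pverts (F i)" "v \<in> pverts (F i)"
      "fst (f i u) = fst (f i v)" "snd (f i u) = snd (f i v)"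
    then show "u = v"
      using bij[of i] by (auto simp: bij_betw_def inj_on_def prod_eq_iff)
  qed
  have "?f ` pverts ?S = (\<Union>i\<in>I. ?t i ` f i ` pverts (F i))"
    by (auto simp: pverts_disjoint_sum image_iff case_prod_beta)
  also have "\<dots> = (\<Union>i\<in>I. ?t i ` pverts (?Q i))"
    using bij by (simp add: bij_betw_def)
  also have "\<dots> = pverts ?P"
    by (auto simp: pverts_disjoint_sum product_h_def)
  finally have verts: "?f ` pverts ?S = pverts ?P" .
  have "parcs ?S = (\<Union>i\<in>I. map_prod (Pair i) (Pair i) ` parcs (F i))"
    by (auto simp: parcs_disjoint_sum)
  then have "map_prod ?f ?f ` parcs ?S = (\<Union>i\<in>I. map_prod (?t i) (?t i) ` map_prod (f i) (f i) ` parcs (F i))"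
    by (simp add: image_UN image_image map_prod_def case_prod_beta)
  also have "\<dots> = (\<Union>i\<in>I. map_prod (?t i) (?t i) ` parcs (?Q i))"
    using arcs by simp
  also have "\<dots> = parcs ?P"
  proof -
    have "(((i, a), x), ((j, b), y)) \<in> (\<Union>i\<in>I. map_prod (?t i) (?t i) ` parcs (?Q i)) \<longleftrightarrow>
        i = j \<and> i \<in> I \<and> ((a, x), (b, y)) \<in> parcs (?Q i)" for i a x j b y
      by (auto intro!: bexI[of _ i] image_eqI[of _ _ "((a, x), (b, y))"])
    moreover have "i = j \<and> i \<in> I \<and> ((a, x), (b, y)) \<in> parcs (?Q i) \<longleftrightarrow> (((i, a), x), ((j, b), y)) \<in> parcs ?P" for i a x j b y
      by (auto simp: und_product_arc_iff parcs_disjoint_sum)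
    ultimately have eq: "(((i, a), x), ((j, b), y)) \<in> (\<Union>i\<in>I. map_prod (?t i) (?t i) ` parcs (?Q i)) \<longleftrightarrow>
        (((i, a), x), ((j, b), y)) \<in> parcs ?P" for i a x j b y
      by (simp only:)
    show ?thesis
    proof (rule set_eqI)
      fix e :: "(('i \<times> 'a) \<times> 'v) \<times> ('i \<times> 'a) \<times> 'v"
      obtain i a x j b y where "e = (((i, a), x), ((j, b), y))"
        by (metis prod.exhaust)
      then show "e \<in> (\<Union>i\<in>I. map_prod (?t i) (?t i) ` parcs (?Q i)) \<longleftrightarrow> e \<in> parcs ?P"
        using eq by (simp only:)
    qed
  qed
  finally show ?thesis
    using inj verts by (simp add: iso_map_def bij_betw_def)
qed

section \<open>Potentials on trees\<close>

text \<open>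
  The potential is grown from the root: a vertex adjacent to the set \<open>S\<close> where it is already
  defined has just one neighbour in \<open>S\<close>, as two of them would be joined by a path in \<open>S\<close> and
  close a cycle.
\<close>

lemma tree_potential:
  assumes T: "tree_graph T" and w: "w \<in> pverts T" and b0: "b0 \<in> B"
    and gB: "\<And>u v b. (u, v) \<in> parcs T \<Longrightarrow> b \<in> B \<Longrightarrow> g u v b \<in> B"
    and gg: "\<And>u v b. (u, v) \<in> parcs T \<Longrightarrow> b \<in> B \<Longrightarrow> g v u (g u v b) = b"
  shows "\<exists>\<theta>. \<theta> w = b0 \<and> (\<forall>u\<in>pverts T. \<theta> u \<in> B) \<and> (\<forall>(u, v)\<in>parcs T. \<theta> v = g u v (\<theta> u))"
proof -
  interpret pair_graph T using T by (simp add: tree_graph_def)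
  have acyclic: "\<not> (cycle p \<and> 3 \<le> length p)" for p
    using T by (auto simp: tree_graph_def)
  have sym: "(v, u) \<in> parcs T" if "(u, v) \<in> parcs T" for u v
    using that by (metis arcs_symmetric)
  \<comment> \<open>The arc relation is symmetric, so connectedness already gives directed
    reachability from the root.\<close>
  have conn: "w \<rightarrow>\<^sup>*\<^bsub>with_proj T\<^esub> v" if "v \<in> pverts T" for v
    using T that w reachable_mk_symmetric_eq[OF sym_arcs]
    by (auto simp: tree_graph_def Digraph_Component.connected_def strongly_connected_def)
  \<comment> \<open>The joining paths must stay inside \<open>S\<close>: they then avoid a vertex
    \<open>v\<close> outside \<open>S\<close>, which makes the closed walk in \<open>uniq\<close> a
    genuine cycle.\<close>
  define linked where "linked S \<longleftrightarrow>
    (\<forall>u\<in>S. \<forall>v\<in>S. \<exists>p. apath u p v \<and> set (pawalk_verts u p) \<subseteq> S)" for S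
  have step: "\<exists>S' \<theta>'. S \<subset> S' \<and> S' \<subseteq> pverts T \<and> linked S' \<and> \<theta>' w = b0 \<and> (\<forall>u\<in>S'. \<theta>' u \<in> B) \<and>
      (\<forall>(u, v)\<in>parcs T \<inter> S' \<times> S'. \<theta>' v = g u v (\<theta>' u))"
    if S: "S \<subseteq> pverts T" "w \<in> S" "linked S" "S \<noteq> pverts T" and \<theta>: "\<theta> w = b0" "\<forall>u\<in>S. \<theta> u \<in> B"
      "\<forall>(u, v)\<in>parcs T \<inter> S \<times> S. \<theta> v = g u v (\<theta> u)" for S and \<theta> :: "'a \<Rightarrow> 'b"
  proof -
    obtain x where x: "x \<in> pverts T" "x \<notin> S" using S by blast
    have "\<exists>s v. (s, v) \<in> parcs T \<and> s \<in> S \<and> v \<notin> S"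
    proof (rule ccontr)
      assume "\<not> ?thesis"
      then have closed: "v \<in> S" if "(s, v) \<in> parcs T" "s \<in> S" for s v
        using that by blast
      have "y \<in> S" if "w \<rightarrow>\<^sup>*\<^bsub>with_proj T\<^esub> y" for y
        using that by (induction rule: reachable_induct) (use S closed in auto)
      then show False using x conn by blast
    qed
    then obtain s v where sv: "(s, v) \<in> parcs T" "s \<in> S" "v \<notin> S" by blast
    have v: "v \<in> pverts T" using sv in_arcsD2 by blast
    have uniq: "s' = s" if s': "(s', v) \<in> parcs T" "s' \<in> S" for s'
    proof (rule ccontr)
      assume "s' \<noteq> s"
      obtain p where p: "apath s p s'" "set (pawalk_verts s p) \<subseteq> S"
        using S(3) sv s' unfolding linked_def by blast
      have "p \<noteq> []" using p(1) \<open>s' \<noteq> s\<close> by (auto simp: apath_Nil_iff)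
      \<comment> \<open>A nonempty \<open>p\<close> between the two steps through \<open>v\<close>
        gives at least three arcs. An edge traversed back and forth has only two and is not excluded
        by \<open>tree_graph\<close>.\<close>
      then have len: "3 \<le> length ((v, s) # p @ [(s', v)])"
        by (cases p) auto
      have aw: "awalk s p s'" "distinct (pawalk_verts s p)" using p(1) by (auto simp: apath_def)
      have aw2: "awalk s (p @ [(s', v)]) v"
        by (rule awalk_appendI[OF aw(1)]) (use s' v in_arcsD1 in \<open>auto simp: awalk_simps\<close>)
      have "pawalk_verts s (p @ [(s', v)]) = pawalk_verts s p @ [v]"
        using awalk_verts_append[OF aw2] aw(1) by simp
      then have "cycle ((v, s) # p @ [(s', v)])"
        unfolding cycle_def using aw2 aw(2) p(2) sv sym by (intro exI[of _ v]) (auto simp: awalk_simps)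
      with acyclic len show False by blast
    qed
    \<comment> \<open>The value at \<open>v\<close> is forced by its only neighbour \<open>s\<close>
      in \<open>S\<close>; \<open>gg\<close> makes the reverse arc from \<open>v\<close> to
      \<open>s\<close> consistent with it.\<close>
    let ?S = "insert v S" and ?\<theta> = "\<theta>(v := g s v (\<theta> s))"
    have linked: "linked ?S"
      unfolding linked_def
    proof (intro ballI)
      fix a b assume ab: "a \<in> ?S" "b \<in> ?S"
      have SS: "\<exists>p. apath a p b \<and> set (pawalk_verts a p) \<subseteq> S" if "a \<in> S" "b \<in> S" for a b
        using S(3) that by (auto simp: linked_def)
      consider "a = v" "b = v" | "a = v" "b \<in> S" | "a \<in> S" "b = v" | "a \<in> S" "b \<in> S"
        using ab by blast
      then show "\<exists>p. apath a p b \<and> set (pawalk_verts a p) \<subseteq> ?S"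
      proof cases
        case 1
        then show ?thesis using v by (intro exI[of _ "[]"]) (auto simp: apath_simps)
      next
        case 2
        then obtain p where "apath s p b" "set (pawalk_verts s p) \<subseteq> S" using SS sv by blast
        then show ?thesis using 2 sv sym by (intro exI[of _ "(v, s) # p"]) (auto simp: apath_simps)
      next
        case 3
        then obtain p where p: "apath a p s" "set (pawalk_verts a p) \<subseteq> S" using SS sv by blast
        have aw: "awalk a p s" "distinct (pawalk_verts a p)" using p(1) by (auto simp: apath_def)
        have aw2: "awalk a (p @ [(s, v)]) v"
          by (rule awalk_appendI[OF aw(1)]) (use sv v in_arcsD1 in \<open>auto simp: awalk_simps\<close>)
        have "pawalk_verts a (p @ [(s, v)]) = pawalk_verts a p @ [v]"
          using awalk_verts_append[OF aw2] aw(1) by simp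
        then show ?thesis
          using 3 aw2 aw p(2) sv by (intro exI[of _ "p @ [(s, v)]"]) (auto simp: apath_def)
      next
        case 4
        then show ?thesis using SS by blast
      qed
    qed
    have pot: "?\<theta> z = g y z (?\<theta> y)" if yz: "(y, z) \<in> parcs T" "y \<in> ?S" "z \<in> ?S" for y z
    proof -
      consider "y \<in> S" "z \<in> S" | "y = v" "z \<in> S" | "y \<in> S" "z = v" | "y = v" "z = v"
        using yz by blast
      then show ?thesis
      proof cases
        case 1
        then have "y \<noteq> v" "z \<noteq> v" using sv by auto
        then show ?thesis using 1 \<theta>(3) yz by auto
      next
        case 2
        then have "z = s" using uniq yz sym by blast
        then show ?thesis using 2 sv gg \<theta>(2) by auto
      next
        case 3
        then have "y = s" using uniq yz by blast
        then show ?thesis using 3 sv by auto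
      next
        case 4
        then show ?thesis using yz no_loops' by blast
      qed
    qed
    have "\<forall>(y, z)\<in>parcs T \<inter> ?S \<times> ?S. ?\<theta> z = g y z (?\<theta> y)"
    proof
      fix e assume "e \<in> parcs T \<inter> ?S \<times> ?S"
      then show "case e of (y, z) \<Rightarrow> ?\<theta> z = g y z (?\<theta> y)"
        using pot by (cases e) (simp only: case_prod_conv Int_iff mem_Sigma_iff)
    qed
    moreover have "S \<subset> ?S" "?S \<subseteq> pverts T" "?\<theta> w = b0" "\<forall>u\<in>?S. ?\<theta> u \<in> B"
      using S sv v gB \<theta> by auto
    ultimately show ?thesis
      using linked by (intro exI[of _ ?S] exI[of _ ?\<theta>] conjI)
  qed
  have "\<exists>\<theta>. \<theta> w = b0 \<and> (\<forall>u\<in>pverts T. \<theta> u \<in> B) \<and> (\<forall>(u, v)\<in>parcs T. \<theta> v = g u v (\<theta> u))"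
    if "S \<subseteq> pverts T" "w \<in> S" "linked S" "\<theta> w = b0" "\<forall>u\<in>S. \<theta> u \<in> B"
      "\<forall>(u, v)\<in>parcs T \<inter> S \<times> S. \<theta> v = g u v (\<theta> u)" for S \<theta>
    using that
  \<comment> \<open>The measure is the number of vertices not yet reached; \<open>step\<close>
    decreases it because \<open>S\<close> grows strictly.\<close>
  proof (induction "card (pverts T - S)" arbitrary: S \<theta> rule: less_induct)
    case less
    show ?case
    proof (cases "S = pverts T")
      case True
      then show ?thesis
        using less.prems in_arcsD1 in_arcsD2 by (intro exI[of _ \<theta>]) fastforce
    next
      case False
      obtain S' \<theta>' where S': "S \<subset> S'" "S' \<subseteq> pverts T" "linked S'" "\<theta>' w = b0" "\<forall>u\<in>S'. \<theta>' u \<in> B"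
        "\<forall>(u, v)\<in>parcs T \<inter> S' \<times> S'. \<theta>' v = g u v (\<theta>' u)"
        using step[OF less.prems(1-3) False less.prems(4-6)] by blast
      have "card (pverts T - S') < card (pverts T - S)"
        using S' pair_finite_verts by (intro psubset_card_mono) auto
      then show ?thesis
        using less.hyps S' less.prems(2) by blast
    qed
  qed
  note extend = this
  show ?thesis
  proof (rule extend)
    show "linked {w}"
      unfolding linked_def using w by (auto intro!: exI[of _ "[]"] simp: apath_simps)
    show "(\<lambda>_. b0) w = b0" ..
    show "\<forall>u\<in>{w}. b0 \<in> B" using b0 by simp
  qed (use w no_loops' in auto)
qed

section \<open>One-regular digraphs as permutations\<close>

text \<open>Out-degree 1 makes the description in \<open>digraph_perm\<close> well defined, so the
  arcs are the graph of a function; in-degree 1 makes that function injective.\<close>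

lemma digraph_perm_unique:
  assumes "one_regular F"
  shows "(x, y) \<in> parcs F \<longleftrightarrow> x \<in> pverts F \<and> y = digraph_perm F x"
    and "\<And>x x' y. (x, y) \<in> parcs F \<Longrightarrow> (x', y) \<in> parcs F \<Longrightarrow> x = x'"
proof -
  interpret pair_fin_digraph F using assms by (simp add: one_regular_def)
  have deg: "card {e \<in> parcs F. fst e = x} = 1" "card {e \<in> parcs F. snd e = x} = 1"
    if "x \<in> pverts F" for x
    using assms that by (auto simp: one_regular_def in_degree_def out_degree_def in_arcs_def out_arcs_def)
  show "x = x'" if "(x, y) \<in> parcs F" "(x', y) \<in> parcs F" for x x' y
  proof -
    have "card {e \<in> parcs F. snd e = y} = 1"
      using deg(2) that in_arcsD2 by blast
    then obtain e where "{e \<in> parcs F. snd e = y} = {e}"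
      by (auto simp: card_1_singleton_iff)
    moreover have "(x, y) \<in> {e \<in> parcs F. snd e = y}" "(x', y) \<in> {e \<in> parcs F. snd e = y}"
      using that by auto
    ultimately show ?thesis by (metis prod.inject singletonD)
  qed
  have "\<exists>!y. (x, y) \<in> parcs F" if x: "x \<in> pverts F" for x
  proof -
    obtain e where e: "{e \<in> parcs F. fst e = x} = {e}"
      using deg(1)[OF x] by (auto simp: card_1_singleton_iff)
    then have "e \<in> parcs F" "fst e = x" by auto
    then have "(x, snd e) \<in> parcs F" by auto
    moreover have "y = snd e" if "(x, y) \<in> parcs F" for y
    proof -
      have "(x, y) \<in> {e \<in> parcs F. fst e = x}" using that by simp
      then have "(x, y) = e" using e by simp
      then show ?thesis by auto
    qed
    ultimately show ?thesis by blast
  qed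
  then have "(x, y) \<in> parcs F \<longleftrightarrow> y = digraph_perm F x" if "x \<in> pverts F"
    using that unfolding digraph_perm_def by (metis (mono_tags, lifting) theI')
  then show "(x, y) \<in> parcs F \<longleftrightarrow> x \<in> pverts F \<and> y = digraph_perm F x"
    using in_arcsD1 by blast
qed

text \<open>An injective map of a finite set into itself is bijective, and outside the vertex set
  \<open>digraph_perm\<close> is the identity by definition.\<close>

lemma digraph_perm_permutes:
  assumes "one_regular F"
  shows "digraph_perm F permutes pverts F"
proof -
  interpret pair_fin_digraph F using assms by (simp add: one_regular_def)
  have arc: "(x, digraph_perm F x) \<in> parcs F" if "x \<in> pverts F" for x
    using digraph_perm_unique(1)[OF assms] that by blast
  have "inj_on (digraph_perm F) (pverts F)"
    using arc digraph_perm_unique(2)[OF assms] by (metis inj_onI)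
  moreover have "digraph_perm F ` pverts F \<subseteq> pverts F"
    using arc in_arcsD2 by blast
  ultimately have "bij_betw (digraph_perm F) (pverts F) (pverts F)"
    using endo_inj_surj[OF pair_finite_verts] unfolding bij_betw_def by blast
  then show ?thesis
    by (rule bij_imp_permutes) (simp add: digraph_perm_def)
qed

section \<open>Positions in powers, unicyclic graphs and disjoint cycles\<close>

lemma nth_concat_replicate:
  "r < k * length xs \<Longrightarrow> concat (replicate k xs) ! r = xs ! (r mod length xs)"
proof (induction k arbitrary: r)
  case (Suc k)
  then show ?case by (auto simp: nth_append le_mod_geq)
qed simp

lemma pverts_unicyclic: "pverts (unicyclic ts) = (SIGMA j:{..<length ts}. pverts (fst (ts ! j)))"
  by (simp add: unicyclic_def pverts_disjoint_sum)

lemma parcs_unicyclic: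
  "parcs (unicyclic ts) = {((j, u), (j, v)) | j u v. j < length ts \<and> (u, v) \<in> parcs (fst (ts ! j))} \<union>
     cycle_arc ts ` {..<length ts} \<union> (cycle_arc ts ` {..<length ts})\<inverse>"
  by (auto simp: unicyclic_def parcs_disjoint_sum cycle_arcs_def Let_def)

text \<open>Applying the cycle to all entries rotates the list by one place; reading this at index
  \<open>q\<close> gives the claim.\<close>

lemma cycle_of_list_nth:
  assumes "distinct cs" "q < length cs"
  shows "cycle_of_list cs (cs ! q) = cs ! (Suc q mod length cs)"
proof -
  have "map (cycle_of_list cs) cs = rotate1 cs"
    using cyclic_rotation[OF assms(1), of 1] by simp
  then have "map (cycle_of_list cs) cs ! q = rotate1 cs ! q" by simp
  then show ?thesis using assms by (simp add: nth_rotate1)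
qed

text \<open>By disjointness every factor other than \<open>\<tau>\<close> fixes the entries of
  \<open>\<tau>\<close>, so only the factor \<open>\<tau>\<close> itself acts on them.\<close>

lemma disjoint_cycles_nth:
  assumes "distinct (concat \<sigma>s)" "\<tau> \<in> set \<sigma>s" "q < length \<tau>"
  shows "foldr (\<lambda>\<sigma>. (\<circ>) (cycle_of_list \<sigma>)) \<sigma>s id (\<tau> ! q) = \<tau> ! (Suc q mod length \<tau>)"
  using assms(1,2)
proof (induction \<sigma>s)
  case (Cons \<rho> \<sigma>s)
  have outside: "foldr (\<lambda>\<sigma>. (\<circ>) (cycle_of_list \<sigma>)) \<sigma>s id x = x" if "x \<notin> set (concat \<sigma>s)" for x
    using that by (induction \<sigma>s) (auto simp: id_outside_supp)
  have "Suc q mod length \<tau> < length \<tau>"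
    using assms(3) by (metis mod_less_divisor length_greater_0_conv list.size(3) not_less_zero)
  then have \<tau>: "\<tau> ! q \<in> set \<tau>" "\<tau> ! (Suc q mod length \<tau>) \<in> set \<tau>"
    using assms(3) by auto
  show ?case
  proof (cases "\<tau> \<in> set \<sigma>s")
    case True
    then have "\<tau> ! (Suc q mod length \<tau>) \<notin> set \<rho>"
      using Cons.prems \<tau> by auto
    then show ?thesis
      using True Cons by (simp add: id_outside_supp)
  next
    case False
    then have "\<tau> = \<rho>" using Cons.prems by simp
    moreover from this have "\<tau> ! q \<notin> set (concat \<sigma>s)"
      using Cons.prems \<tau> by auto
    moreover have "foldr (\<lambda>\<sigma>. (\<circ>) (cycle_of_list \<sigma>)) (\<rho> # \<sigma>s) id (\<tau> ! q) =
      cycle_of_list \<rho> (foldr (\<lambda>\<sigma>. (\<circ>) (cycle_of_list \<sigma>)) \<sigma>s id (\<tau> ! q))"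
      by simp
    ultimately show ?thesis
      using Cons.prems(1) assms(3) outside[of "\<tau> ! q"] cycle_of_list_nth[of \<tau> q]
      by (metis concat.simps(2) distinct_append)
  qed
qed simp

section \<open>Products as voltage covers\<close>

text \<open>This is the derived graph of a permutation voltage assignment. That opposite arcs carry
  inverse voltages is not built in; it is supplied by \<open>transport_transport\<close> and by the
  assumption \<open>gg\<close> of \<open>unicyclic_cover\<close>.\<close>

definition voltage_cover ::
    "'a pair_pre_digraph \<Rightarrow> 'v set \<Rightarrow> ('a \<Rightarrow> 'a \<Rightarrow> 'v \<Rightarrow> 'v) \<Rightarrow> ('a \<times> 'v) pair_pre_digraph" where
  "voltage_cover G V g = \<lparr>pverts = pverts G \<times> V,
    parcs = {((a, x), (b, g a b x)) | a b x. (a, b) \<in> parcs G \<and> x \<in> V}\<rparr>"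

text \<open>The voltage of an edge of \<open>und D\<close> in the direction from \<open>a\<close> to
  \<open>b\<close>. As \<open>parcs D\<close> is asymmetric, exactly one branch is right for each
  edge, and the two directions get mutually inverse permutations.\<close>

definition transport ::
    "'a pair_pre_digraph \<Rightarrow> ('a \<times> 'a \<Rightarrow> 'v pair_pre_digraph) \<Rightarrow> 'a \<Rightarrow> 'a \<Rightarrow> 'v \<Rightarrow> 'v" where
  "transport D h a b =
    (if (a, b) \<in> parcs D then digraph_perm (h (a, b)) else inv (digraph_perm (h (b, a))))"

context
  fixes D :: "'a pair_pre_digraph" and h :: "'a \<times> 'a \<Rightarrow> 'v pair_pre_digraph" and V :: "'v set"
  assumes asym: "asym (parcs D)"
    and h: "\<And>e. e \<in> parcs D \<Longrightarrow> one_regular (h e) \<and> pverts (h e) = V"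
begin

lemma transport_permutes:
  assumes "(a, b) \<in> parcs (und D)"
  shows "transport D h a b permutes V"
  using assms h digraph_perm_permutes permutes_inv
  by (fastforce simp: transport_def parcs_und)

lemma transport_transport:
  assumes "(a, b) \<in> parcs (und D)"
  shows "transport D h b a (transport D h a b x) = x"
proof -
  have perm: "digraph_perm (h e) permutes V" if "e \<in> parcs D" for e
    using h[OF that] digraph_perm_permutes by blast
  consider "(a, b) \<in> parcs D" "(b, a) \<notin> parcs D" | "(b, a) \<in> parcs D" "(a, b) \<notin> parcs D"
    using assms asymD[OF asym] by (auto simp: parcs_und)
  then show ?thesis
    using permutes_inverses[OF perm] by cases (simp_all add: transport_def)
qed

text \<open>Reversing an arc of the product reverses the arc of \<open>D\<close> below it and
  inverts its permutation. So symmetrising the product adds exactly the lifts of the reversed arcs;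
  \<open>swap\<close> reads a lifted edge from its other end.\<close>

lemma und_product_eq_voltage_cover:
  "und (product_h D h V) = voltage_cover (und D) V (transport D h)"
proof -
  have arc: "(x, y) \<in> parcs (h (a, b)) \<longleftrightarrow> x \<in> V \<and> y = transport D h a b x"
    if "(a, b) \<in> parcs D" for a b x y
    using digraph_perm_unique(1) h[OF that] that by (fastforce simp: transport_def)
  have swap: "x \<in> V \<and> y = transport D h a b x \<longleftrightarrow> y \<in> V \<and> x = transport D h b a y"
    if "(a, b) \<in> parcs (und D)" for a b x y
  proof -
    have ba: "(b, a) \<in> parcs (und D)" using that by (auto simp: parcs_und)
    show ?thesis
      using transport_transport[OF that] transport_transport[OF ba]
        permutes_in_image[OF transport_permutes[OF that]]
        permutes_in_image[OF transport_permutes[OF ba]] by metis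
  qed
  let ?L = "parcs (und (product_h D h V))" and ?R = "parcs (voltage_cover (und D) V (transport D h))"
  have "((a, x), (b, y)) \<in> ?L \<longleftrightarrow> ((a, x), (b, y)) \<in> ?R" for a b x y
  proof -
    have "((a, x), (b, y)) \<in> ?L \<longleftrightarrow> (a, b) \<in> parcs D \<and> (x, y) \<in> parcs (h (a, b)) \<or>
        (b, a) \<in> parcs D \<and> (y, x) \<in> parcs (h (b, a))"
      by (rule und_product_arc_iff)
    also have "\<dots> \<longleftrightarrow> (a, b) \<in> parcs (und D) \<and> x \<in> V \<and> y = transport D h a b x"
      using arc[of a b x y] arc[of b a y x] swap[of a b x y] by (auto simp: parcs_und)
    finally show ?thesis by (auto simp: voltage_cover_def)
  qed
  then have "?L = ?R" by auto
  then show ?thesis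
    by (auto intro!: pair_pre_digraph.equality simp: voltage_cover_def product_h_def)
qed

end

section \<open>Voltage covers of unicyclic graphs\<close>

lemma image_map_prod_converse: "map_prod f f ` (S\<inverse>) = (map_prod f f ` S)\<inverse>"
  by (auto intro: rev_image_eqI)

text \<open>
  Position \<open>r\<close> of the \<open>c\<close>-th power is sent to position \<open>r mod m\<close> of the base, on the sheet that the
  potential assigns to entry \<open>r div m\<close> of the \<open>c\<close>-th cycle.
\<close>

lemma unicyclic_cover:
  fixes g :: "nat \<times> 'a \<Rightarrow> nat \<times> 'a \<Rightarrow> 'v \<Rightarrow> 'v"
  assumes trees: "\<And>T w. (T, w) \<in> set ts \<Longrightarrow> tree_graph T \<and> w \<in> pverts T" and "ts \<noteq> []"
    and perm: "\<And>a b. (a, b) \<in> parcs (unicyclic ts) \<Longrightarrow> g a b permutes V"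
    and gg: "\<And>a b x. (a, b) \<in> parcs (unicyclic ts) \<Longrightarrow> g b a (g a b x) = x"
    and dec: "cycle_decomposition_of V (fold (\<lambda>(a, b) p. g a b \<circ> p) (cycle_arcs ts) id) \<sigma>"
  shows "\<exists>f. iso_map f (disjoint_sum {..<length \<sigma>} (\<lambda>c. unicyclic_power ts (length (\<sigma> ! c))))
    (voltage_cover (unicyclic ts) V g)"
proof -
  define m where "m = length ts"
  define T where "T j = fst (ts ! j)" for j
  define W where "W j = snd (ts ! j)" for j
  define n where "n c = length (\<sigma> ! c)" for c
  have m: "0 < m" using \<open>ts \<noteq> []\<close> by (simp add: m_def)
  have TW: "tree_graph (T j)" "W j \<in> pverts (T j)" if "j < m" for j
    using trees[of "T j" "W j"] that by (auto simp: T_def W_def m_def)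
  have U: "parcs (unicyclic ts) = {((j, u), (j, v)) | j u v. j < m \<and> (u, v) \<in> parcs (T j)} \<union>
      (\<lambda>j. ((j, W j), (Suc j mod m, W (Suc j mod m)))) ` {..<m} \<union>
      ((\<lambda>j. ((j, W j), (Suc j mod m, W (Suc j mod m)))) ` {..<m})\<inverse>"
    unfolding parcs_unicyclic by (simp add: cycle_arc_def cycle_vertex_def T_def W_def m_def)
  \<comment> \<open>The accumulated voltage along the first \<open>j\<close> arcs of the cycle. For
    \<open>j = m\<close> this is the whole permutation whose cycles are listed in
    \<open>\<sigma>\<close>.\<close>
  define base where "base j = fold (\<lambda>(a, b) p. g a b \<circ> p) (map (cycle_arc ts) [0..<j]) id" for j
  have base_Suc: "base (Suc j) = g (j, W j) (Suc j mod m, W (Suc j mod m)) \<circ> base j" for j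
    by (simp add: base_def cycle_arc_def cycle_vertex_def W_def m_def)
  have base_0: "base 0 = id" by (simp add: base_def)
  have base_perm: "base j permutes V" if "j \<le> m" for j
    using that
  proof (induction j)
    case 0
    then show ?case by (simp add: base_0 permutes_id[unfolded id_def])
  next
    case (Suc j)
    then have "g (j, W j) (Suc j mod m, W (Suc j mod m)) permutes V"
      by (intro perm) (auto simp: U)
    with Suc show ?case by (simp add: base_Suc permutes_compose del: o_apply)
  qed
  \<comment> \<open>Normalising the root of tree \<open>j\<close> to \<open>base j\<close> rather
    than to the identity makes the sheet label constant along the cycle arcs before the last one;
    all monodromy is collected at the arc back to position 0.\<close>
  define pot where "pot j \<theta> \<longleftrightarrow> \<theta> (W j) = base j \<and> (\<forall>u\<in>pverts (T j). \<theta> u \<in> {p. p permutes V}) \<and>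
      (\<forall>(u, v)\<in>parcs (T j). \<theta> v = g (j, u) (j, v) \<circ> \<theta> u)" for j \<theta>
  have "\<exists>\<theta>. pot j \<theta>" if "j < m" for j
    unfolding pot_def
  \<comment> \<open>Here \<open>B\<close> consists of the permutations of \<open>V\<close>, and an
    arc acts on them by composition from the left.\<close>
  proof (rule tree_potential[where g = "\<lambda>u v b. g (j, u) (j, v) \<circ> b"])
    fix u v b
    assume "(u, v) \<in> parcs (T j)" "b \<in> {p. p permutes V}"
    then show "g (j, u) (j, v) \<circ> b \<in> {p. p permutes V}"
      using permutes_compose[OF _ perm[of "(j, u)" "(j, v)"]] that by (auto simp: U)
  next
    fix u v and b :: "'v \<Rightarrow> 'v"
    assume "(u, v) \<in> parcs (T j)"
    then show "g (j, v) (j, u) \<circ> (g (j, u) (j, v) \<circ> b) = b"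
      using gg[of "(j, u)" "(j, v)"] that by (auto simp: U fun_eq_iff)
  qed (use that TW base_perm in auto)
  then obtain \<theta> where "\<And>j. j < m \<Longrightarrow> pot j (\<theta> j)"
    by metis
  then have \<theta>_W: "\<And>j. j < m \<Longrightarrow> \<theta> j (W j) = base j"
    and \<theta>_perm: "\<And>j u. j < m \<Longrightarrow> u \<in> pverts (T j) \<Longrightarrow> \<theta> j u permutes V"
    and \<theta>_arc: "\<And>j u v. j < m \<Longrightarrow> (u, v) \<in> parcs (T j) \<Longrightarrow> \<theta> j v = g (j, u) (j, v) \<circ> \<theta> j u"
    unfolding pot_def by blast+

  have \<sigma>: "[] \<notin> set \<sigma>" "distinct (concat \<sigma>)" "set (concat \<sigma>) = V"
      "base m = foldr (\<lambda>\<sigma>. (\<circ>) (cycle_of_list \<sigma>)) \<sigma> id"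
    using dec unfolding cycle_decomposition_of_def base_def cycle_arcs_def m_def by auto
  have rotate: "base m (\<sigma> ! c ! q) = \<sigma> ! c ! (Suc q mod n c)" if "c < length \<sigma>" "q < n c" for c q
    using disjoint_cycles_nth[OF \<sigma>(2) nth_mem[OF that(1)]] that(2) unfolding \<sigma>(4) n_def by blast
  \<comment> \<open>This and the next two facts say that the entries \<open>\<sigma> ! c ! q\<close>
    enumerate \<open>V\<close> without repetition, so the pairs \<open>(c, q)\<close> can serve as
    sheet labels.\<close>
  have \<sigma>_V: "\<sigma> ! c ! q \<in> V" if "c < length \<sigma>" "q < n c" for c q
  proof -
    have "\<sigma> ! c ! q \<in> set (concat \<sigma>)"
      using that by (auto simp: n_def intro!: bexI[of _ "\<sigma> ! c"])
    then show ?thesis by (simp only: \<sigma>(3))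
  qed
  have \<sigma>_surj: "\<exists>c q. c < length \<sigma> \<and> q < n c \<and> \<sigma> ! c ! q = x" if "x \<in> V" for x
  proof -
    have "x \<in> set (concat \<sigma>)" using that by (simp only: \<sigma>(3))
    then obtain cs where "cs \<in> set \<sigma>" "x \<in> set cs" by auto
    then show ?thesis unfolding n_def by (metis in_set_conv_nth)
  qed
  have \<sigma>_inj: "c = c' \<and> q = q'" if "c < length \<sigma>" "q < n c" "c' < length \<sigma>" "q' < n c'"
    "\<sigma> ! c ! q = \<sigma> ! c' ! q'" for c q c' q'
  proof -
    have dist: "distinct \<sigma>" "\<And>cs. cs \<in> set \<sigma> \<Longrightarrow> distinct cs"
      "\<And>cs ds. cs \<in> set \<sigma> \<Longrightarrow> ds \<in> set \<sigma> \<Longrightarrow> cs \<noteq> ds \<Longrightarrow> set cs \<inter> set ds = {}"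
      using \<sigma>(1,2) by (auto simp: distinct_concat_iff)
    have "\<sigma> ! c ! q \<in> set (\<sigma> ! c) \<inter> set (\<sigma> ! c')"
      using that by (auto simp: n_def) (metis nth_mem)
    then have "\<sigma> ! c = \<sigma> ! c'" using dist(3) that by (metis empty_iff nth_mem)
    then have "c = c'" using dist(1) that by (simp add: nth_eq_iff_index_eq)
    moreover from this have "q = q'"
      using dist(2) that by (simp add: n_def nth_eq_iff_index_eq)
    ultimately show ?thesis ..
  qed

  let ?H = "disjoint_sum {..<length \<sigma>} (\<lambda>c. unicyclic_power ts (length (\<sigma> ! c)))"
  let ?G = "voltage_cover (unicyclic ts) V g"
  let ?f = "\<lambda>(c, r, u). ((r mod m, u), \<theta> (r mod m) u (\<sigma> ! c ! (r div m)))"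
  let ?step = "\<lambda>c r. ((c, r, W (r mod m)), (c, Suc r mod (n c * m), W (Suc r mod m)))"
  let ?rs = "SIGMA c:{..<length \<sigma>}. {..<n c * m}"
  \<comment> \<open>Since \<open>m\<close> divides \<open>n c * m\<close>, wrapping around the long
    cycle is compatible with wrapping around the base cycle.\<close>
  have Suc_mod: "Suc r mod (n c * m) mod m = Suc r mod m" for r c
    by (simp add: mod_mod_cancel)
  have div_less: "r div m < n c" if "r < n c * m" for r c
    using that m by (simp add: less_mult_imp_div_less)
  have nth: "concat (replicate (n c) ts) ! r = ts ! (r mod m)" if "r < n c * m" for c r
    using nth_concat_replicate[of r "n c" ts] that by (simp add: m_def)
  have len: "length (concat (replicate (n c) ts)) = n c * m" for c
    by (simp add: length_concat sum_list_replicate m_def)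
  have H_verts: "pverts ?H = {(c, r, u). (c, r) \<in> ?rs \<and> u \<in> pverts (T (r mod m))}"
    by (auto simp: pverts_disjoint_sum unicyclic_power_def pverts_unicyclic nth T_def
        len[unfolded n_def] nth[unfolded n_def] n_def)
  have cycle_arc_power: "cycle_arc (concat (replicate (n c) ts)) r =
      ((r, W (r mod m)), (Suc r mod (n c * m), W (Suc r mod m)))" if "r < n c * m" for c r
  proof -
    have "Suc r mod (n c * m) < n c * m" by (rule mod_less_divisor[OF order.strict_trans1[OF le0 that]])
    then show ?thesis
      using that nth[of r c] nth[of "Suc r mod (n c * m)" c]
      by (simp add: cycle_arc_def cycle_vertex_def len W_def Suc_mod)
  qed
  have power_arcs: "parcs (unicyclic_power ts (n c)) =
      {((r, u), (r, v)) | r u v. r < n c * m \<and> (u, v) \<in> parcs (T (r mod m))} \<union>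
      (\<lambda>r. ((r, W (r mod m)), (Suc r mod (n c * m), W (Suc r mod m)))) ` {..<n c * m} \<union>
      ((\<lambda>r. ((r, W (r mod m)), (Suc r mod (n c * m), W (Suc r mod m)))) ` {..<n c * m})\<inverse>" for c
  proof -
    have "cycle_arc (concat (replicate (n c) ts)) ` {..<n c * m} =
        (\<lambda>r. ((r, W (r mod m)), (Suc r mod (n c * m), W (Suc r mod m)))) ` {..<n c * m}"
      using cycle_arc_power by (intro image_cong) auto
    then show ?thesis
      unfolding unicyclic_power_def parcs_unicyclic len using nth by (auto simp: T_def)
  qed
  have H_arcs: "parcs ?H = {((c, r, u), (c, r, v)) | c r u v. (c, r) \<in> ?rs \<and> (u, v) \<in> parcs (T (r mod m))} \<union>
      (\<lambda>(c, r). ?step c r) ` ?rs \<union> ((\<lambda>(c, r). ?step c r) ` ?rs)\<inverse>"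
    unfolding parcs_disjoint_sum n_def[symmetric] power_arcs by auto

  have f_verts: "?f (c, r, u) \<in> pverts ?G" if "(c, r) \<in> ?rs" "u \<in> pverts (T (r mod m))" for c r u
    using that m \<sigma>_V div_less permutes_in_image[OF \<theta>_perm]
    by (auto simp: voltage_cover_def pverts_unicyclic m_def[symmetric] T_def[symmetric])
  have f_V: "snd (?f (c, r, u)) \<in> V" if "(c, r) \<in> ?rs" "u \<in> pverts (T (r mod m))" for c r u
    using f_verts[OF that] by (simp add: voltage_cover_def)
  \<comment> \<open>The sheet \<open>x\<close> over \<open>u\<close> has label
    \<open>inv (\<theta> j u) x\<close>. If this is entry \<open>q\<close> of cycle
    \<open>c\<close>, the preimage sits at position \<open>q * m + j\<close>. The witness depends on
    \<open>u\<close>, so an arc is later lifted back by choosing it for the tail.\<close>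
  have f_surj: "\<exists>c r. (c, r) \<in> ?rs \<and> r mod m = j \<and> ?f (c, r, u) = ((j, u), x)"
    if "j < m" "u \<in> pverts (T j)" "x \<in> V" for j u x
  proof -
    have "inv (\<theta> j u) x \<in> V"
      using \<theta>_perm that permutes_in_image permutes_inv by metis
    then obtain c q where cq: "c < length \<sigma>" "q < n c" "\<sigma> ! c ! q = inv (\<theta> j u) x"
      using \<sigma>_surj by blast
    have "q * m + j < Suc q * m" using that by simp
    also have "\<dots> \<le> n c * m" using cq by (intro mult_le_mono1) simp
    finally have "(c, q * m + j) \<in> ?rs" using cq by simp
    moreover have "?f (c, q * m + j, u) = ((j, u), x)"
      using that cq permutes_inverses(1)[OF \<theta>_perm] by simp
    moreover have "(q * m + j) mod m = j" using that by simp
    ultimately show ?thesis by blast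
  qed
  have f_inj: "inj_on ?f (pverts ?H)"
  proof (rule inj_onI, unfold H_verts, clarsimp)
    fix c r u c' r'
    assume *: "c < length \<sigma>" "r < n c * m" "c' < length \<sigma>" "r' < n c' * m" "r mod m = r' mod m"
      "u \<in> pverts (T (r' mod m))"
      "\<theta> (r' mod m) u (\<sigma> ! c ! (r div m)) = \<theta> (r' mod m) u (\<sigma> ! c' ! (r' div m))"
    then have "\<sigma> ! c ! (r div m) = \<sigma> ! c' ! (r' div m)"
      using permutes_inj[OF \<theta>_perm] m by (meson injD mod_less_divisor)
    then have "c = c' \<and> r div m = r' div m"
      using * div_less by (intro \<sigma>_inj) auto
    then show "c = c' \<and> r = r'"
      using * by (metis div_mult_mod_eq)
  qed
  have "?f ` pverts ?H = pverts ?G"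
  proof
    show "?f ` pverts ?H \<subseteq> pverts ?G" using f_verts by (force simp: H_verts)
    show "pverts ?G \<subseteq> ?f ` pverts ?H"
    proof clarify
      fix j u x assume "((j, u), x) \<in> pverts ?G"
      then have *: "j < m" "u \<in> pverts (T j)" "x \<in> V"
        by (auto simp: voltage_cover_def pverts_unicyclic m_def T_def)
      then obtain c r where "(c, r) \<in> ?rs" "r mod m = j" "?f (c, r, u) = ((j, u), x)"
        using f_surj by blast
      then show "((j, u), x) \<in> ?f ` pverts ?H"
        using * by (intro image_eqI[of _ _ "(c, r, u)"]) (auto simp: H_verts)
    qed
  qed
  with f_inj have bij: "bij_betw ?f (pverts ?H) (pverts ?G)"
    by (simp add: bij_betw_def)

  \<comment> \<open>The lift of the \<open>j\<close>-th cycle arc that starts on sheet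
    \<open>x\<close> over \<open>W j\<close>.\<close>
  define succ where "succ = (\<lambda>(j, x). (((j, W j), x),
    ((Suc j mod m, W (Suc j mod m)), g (j, W j) (Suc j mod m, W (Suc j mod m)) x)))"
  have f_step: "map_prod ?f ?f (?step c r) = succ (r mod m, \<theta> (r mod m) (W (r mod m)) (\<sigma> ! c ! (r div m)))"
    if "(c, r) \<in> ?rs" for c r
  proof -
    let ?j = "r mod m" and ?q = "r div m"
    have j: "?j < m" using m by simp
    have cq: "c < length \<sigma>" "r < n c * m" "?q < n c" using that div_less by auto
    have "\<theta> (Suc r mod m) (W (Suc r mod m)) (\<sigma> ! c ! (Suc r mod (n c * m) div m)) =
        g (?j, W ?j) (Suc ?j mod m, W (Suc ?j mod m)) (base ?j (\<sigma> ! c ! ?q))"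
    proof (cases "Suc ?j = m")
      \<comment> \<open>Inside one copy of \<open>ts\<close> the label stays at entry
        \<open>?q\<close>, and the new voltage is absorbed by passing from \<open>base ?j\<close> to
        \<open>base (Suc ?j)\<close>.\<close>
      case False
      then have "Suc ?j < m" using j by simp
      then have Suc_r: "Suc r mod m = Suc ?j" "Suc r div m = ?q"
        by (auto simp: mod_Suc div_Suc)
      then have "Suc r < n c * m"
        using cq(3) m by (metis div_less_iff_less_mult)
      then show ?thesis
        using Suc_r \<open>Suc ?j < m\<close> \<theta>_W base_Suc[of ?j] by simp
    next
      \<comment> \<open>At the end of a copy the next position is the start of the following copy,
        cyclically, so the entry index advances by one modulo \<open>n c\<close>. The target root
        has potential \<open>base 0 = id\<close>, and \<open>rotate\<close> says that the advanced
        entry is \<open>base m\<close> of the old one.\<close>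
      case True
      then have Suc_r: "Suc r mod m = 0" "Suc r = Suc ?q * m"
        by (simp add: mod_Suc, metis add_Suc_right add.commute mult.commute mult_Suc True mult_div_mod_eq)
      have "Suc r mod (n c * m) div m = Suc ?q mod n c"
        unfolding Suc_r(2) using m by (simp add: mult_mod_left[symmetric] del: mult_Suc)
      then have "\<theta> (Suc r mod m) (W (Suc r mod m)) (\<sigma> ! c ! (Suc r mod (n c * m) div m)) =
          base m (\<sigma> ! c ! ?q)"
        using Suc_r(1) rotate[OF cq(1,3)] \<theta>_W[OF m] base_0 by simp
      also have "\<dots> = g (?j, W ?j) (Suc ?j mod m, W (Suc ?j mod m)) (base ?j (\<sigma> ! c ! ?q))"
        using base_Suc[of ?j] True by simp
      finally show ?thesis .
    qed
    then show ?thesis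
      using \<theta>_W[OF j] by (simp add: succ_def Suc_mod mod_Suc_eq)
  qed
  \<comment> \<open>The map \<open>?k\<close> sends a position to the root vertex of the cover to
    which \<open>?f\<close> takes it; by \<open>f_surj\<close> all of these are reached, so the
    images are exactly the lifts of the cycle arcs.\<close>
  have steps: "map_prod ?f ?f ` (\<lambda>(c, r). ?step c r) ` ?rs = succ ` ({..<m} \<times> V)"
  proof -
    let ?k = "\<lambda>(c, r). (r mod m, \<theta> (r mod m) (W (r mod m)) (\<sigma> ! c ! (r div m)))"
    have "?k ` ?rs = {..<m} \<times> V"
    proof
      show "?k ` ?rs \<subseteq> {..<m} \<times> V"
      proof (rule image_subsetI)
        fix p assume p: "p \<in> ?rs"
        obtain c r where cr: "p = (c, r)" by fastforce
        have "snd (?f (c, r, W (r mod m))) \<in> V"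
          by (rule f_V) (use p cr m TW(2) in auto)
        then show "?k p \<in> {..<m} \<times> V"
          using m cr by simp
      qed
      show "{..<m} \<times> V \<subseteq> ?k ` ?rs"
      proof clarify
        fix j x assume "j < m" "x \<in> V"
        then obtain c r where "(c, r) \<in> ?rs" "r mod m = j" "?f (c, r, W j) = ((j, W j), x)"
          using f_surj TW(2) by blast
        then show "(j, x) \<in> ?k ` ?rs" by (intro image_eqI[of _ _ "(c, r)"]) auto
      qed
    qed
    moreover have "map_prod ?f ?f ` (\<lambda>(c, r). ?step c r) ` ?rs = succ ` ?k ` ?rs"
      unfolding image_image using f_step by (intro image_cong) auto
    ultimately show ?thesis by simp
  qed
  \<comment> \<open>The equation \<open>\<theta>_arc\<close> says that both ends of a tree arc, with
    the same label, go to the two ends of one lifted arc; \<open>f_surj\<close> at the tail shows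
    that every lift occurs.\<close>
  have tree_arcs: "map_prod ?f ?f ` {((c, r, u), (c, r, v)) | c r u v. (c, r) \<in> ?rs \<and> (u, v) \<in> parcs (T (r mod m))} =
      {(((j, u), x), ((j, v), g (j, u) (j, v) x)) | j u v x. j < m \<and> (u, v) \<in> parcs (T j) \<and> x \<in> V}"
    (is "_ ` ?A = ?B")
  proof
    have wfT: "u \<in> pverts (T j)" if "j < m" "(u, v) \<in> parcs (T j)" for j u v
      using TW(1)[OF that(1)] that(2) pair_wf_digraph.in_arcsD1
      by (fastforce simp: tree_graph_def pair_graph_def pair_digraph_def pair_fin_digraph_def)
    have img: "map_prod ?f ?f ((c, r, u), (c, r, v)) =
        (((r mod m, u), snd (?f (c, r, u))), ((r mod m, v), g (r mod m, u) (r mod m, v) (snd (?f (c, r, u)))))"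
      if "(u, v) \<in> parcs (T (r mod m))" for c r u v
      using \<theta>_arc[OF _ that] m by simp
    show "map_prod ?f ?f ` ?A \<subseteq> ?B"
    proof (rule image_subsetI)
      fix e assume "e \<in> ?A"
      then obtain c r u v where e: "e = ((c, r, u), (c, r, v))"
        and *: "(c, r) \<in> ?rs" "(u, v) \<in> parcs (T (r mod m))"
        by blast
      have "r mod m < m" "snd (?f (c, r, u)) \<in> V"
        using f_V[OF *(1) wfT[OF _ *(2)]] m by auto
      then show "map_prod ?f ?f e \<in> ?B"
        unfolding e img[OF *(2)] using *(2) by blast
    qed
    show "?B \<subseteq> map_prod ?f ?f ` ?A"
    proof clarify
      fix j u v x assume *: "j < m" "(u, v) \<in> parcs (T j)" "x \<in> V"
      then obtain c r where cr: "(c, r) \<in> ?rs" "r mod m = j" "?f (c, r, u) = ((j, u), x)"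
        using f_surj wfT by blast
      then have "map_prod ?f ?f ((c, r, u), (c, r, v)) = (((j, u), x), ((j, v), g (j, u) (j, v) x))"
        using img[of u v r c] * by simp
      then show "(((j, u), x), ((j, v), g (j, u) (j, v) x)) \<in> map_prod ?f ?f ` ?A"
        using cr(1,2) *(2) by (intro image_eqI[of _ _ "((c, r, u), (c, r, v))"]) auto
    qed
  qed
  let ?arc = "\<lambda>j. ((j, W j), (Suc j mod m, W (Suc j mod m)))"
  \<comment> \<open>By \<open>gg\<close> the voltages of opposite arcs are inverse, so the reverse
    of a lifted cycle arc is a lift of the reversed arc.\<close>
  have succ_conv: "(succ ` ({..<m} \<times> V))\<inverse> =
      {((a, x), (b, g a b x)) | a b x. (b, a) \<in> ?arc ` {..<m} \<and> x \<in> V}"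
    (is "_ = ?C")
  proof -
    have "((b, y), (a, x)) \<in> succ ` ({..<m} \<times> V) \<longleftrightarrow> ((a, x), (b, y)) \<in> ?C" for a b x y
    proof -
      have "((b, y), (a, x)) \<in> succ ` ({..<m} \<times> V) \<longleftrightarrow>
          (b, a) \<in> ?arc ` {..<m} \<and> y \<in> V \<and> x = g b a y"
        by (auto simp: succ_def)
      also have "\<dots> \<longleftrightarrow> (b, a) \<in> ?arc ` {..<m} \<and> x \<in> V \<and> y = g a b x"
      proof (rule conj_cong[OF refl])
        assume "(b, a) \<in> ?arc ` {..<m}"
        then have ba: "(b, a) \<in> parcs (unicyclic ts)" and ab: "(a, b) \<in> parcs (unicyclic ts)"
          unfolding U by blast+
        show "y \<in> V \<and> x = g b a y \<longleftrightarrow> x \<in> V \<and> y = g a b x"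
          using gg[OF ab] gg[OF ba] permutes_in_image[OF perm[OF ab]] permutes_in_image[OF perm[OF ba]]
          by metis
      qed
      also have "\<dots> \<longleftrightarrow> ((a, x), (b, y)) \<in> ?C" by blast
      finally show ?thesis .
    qed
    then show ?thesis by (auto simp only: set_eq_iff split_paired_All converse_iff)
  qed
  \<comment> \<open>The arcs of the cover over a set of base arcs. Additivity lets tree arcs, cycle
    arcs and reversed cycle arcs be compared separately.\<close>
  define lift where "lift S = {((a, x), (b, g a b x)) | a b x. (a, b) \<in> S \<and> x \<in> V}" for S
  have lift_Un: "lift (S \<union> S') = lift S \<union> lift S'" for S S'
    unfolding lift_def by blast
  have "map_prod ?f ?f ` parcs ?H = parcs ?G"
  proof -
    have "map_prod ?f ?f ` parcs ?H = map_prod ?f ?f ` {((c, r, u), (c, r, v)) | c r u v. (c, r) \<in> ?rs \<and> (u, v) \<in> parcs (T (r mod m))} \<union>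
        succ ` ({..<m} \<times> V) \<union> (succ ` ({..<m} \<times> V))\<inverse>"
      unfolding H_arcs image_Un image_map_prod_converse steps ..
    also have "\<dots> = lift {((j, u), (j, v)) | j u v. j < m \<and> (u, v) \<in> parcs (T j)} \<union>
        lift (?arc ` {..<m}) \<union> lift ((?arc ` {..<m})\<inverse>)"
    proof (intro arg_cong2[where f = "(\<union>)"])
      show "succ ` ({..<m} \<times> V) = lift (?arc ` {..<m})"
        unfolding lift_def succ_def by (auto simp: image_iff)
      show "(succ ` ({..<m} \<times> V))\<inverse> = lift ((?arc ` {..<m})\<inverse>)"
        unfolding succ_conv lift_def by (simp only: converse_iff)
    qed (unfold tree_arcs lift_def, blast)
    also have "\<dots> = lift (parcs (unicyclic ts))"
      unfolding U lift_Un ..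
    also have "\<dots> = parcs ?G"
      by (simp add: voltage_cover_def lift_def)
    finally show ?thesis .
  qed
  with bij show ?thesis by (auto simp: iso_map_def)
qed

section \<open>One component, and the sum of all components\<close>

lemma tree_graph_wf: "tree_graph T \<Longrightarrow> pair_wf_digraph T"
  by (simp add: tree_graph_def pair_graph_def pair_digraph_def pair_fin_digraph_def)

lemma unicyclic_wf:
  assumes "\<And>T w. (T, w) \<in> set ts \<Longrightarrow> pair_wf_digraph T \<and> w \<in> pverts T"
  shows "pair_wf_digraph (unicyclic ts)"
proof -
  have *: "pair_wf_digraph (fst (ts ! j)) \<and> snd (ts ! j) \<in> pverts (fst (ts ! j))" if "j < length ts" for j
    using assms[of "fst (ts ! j)" "snd (ts ! j)"] that by simp
  have "u \<in> pverts (unicyclic ts) \<and> v \<in> pverts (unicyclic ts)" if uv: "(u, v) \<in> parcs (unicyclic ts)" for u v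
  proof -
    have cycle: "cycle_vertex ts (k mod length ts) \<in> pverts (unicyclic ts)" if "ts \<noteq> []" for k
      using * that by (simp add: cycle_vertex_def pverts_unicyclic)
    consider j u' v' where "j < length ts" "(u', v') \<in> parcs (fst (ts ! j))" "u = (j, u')" "v = (j, v')"
      | j where "j < length ts" "(u, v) = cycle_arc ts j \<or> (v, u) = cycle_arc ts j"
      using uv unfolding parcs_unicyclic by blast
    then show ?thesis
    proof cases
      case 1
      then show ?thesis
        using * pair_wf_digraph.in_arcsD1 pair_wf_digraph.in_arcsD2 by (fastforce simp: pverts_unicyclic)
    next
      case 2
      then have "ts \<noteq> []" by auto
      then show ?thesis
        using 2 cycle[of j] cycle[of "Suc j"] by (auto simp: cycle_arc_def)
    qed
  qed
  then show ?thesis by unfold_locales auto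
qed

text \<open>The cover theorem is applied with the voltages \<open>transport D h\<close>. The cycle
  arcs belong to \<open>D\<close>, so they are crossed forwards and their accumulated voltage is
  \<open>composed_perm h\<close>.\<close>

lemma iso_map_unicyclic_product:
  assumes trees: "\<And>T w. (T, w) \<in> set ts \<Longrightarrow> tree_graph T \<and> w \<in> pverts T" and "ts \<noteq> []"
    and orientation: "orientation_of D (unicyclic ts)"
    and cycle: "set (cycle_arcs ts) \<subseteq> parcs D"
    and h: "\<And>e. e \<in> parcs D \<Longrightarrow> one_regular (h e) \<and> pverts (h e) = V"
    and dec: "cycle_decomposition_of V (composed_perm h (cycle_arcs ts)) \<sigma>"
  shows "\<exists>f. iso_map f (disjoint_sum {..<length \<sigma>} (\<lambda>c. unicyclic_power ts (length (\<sigma> ! c))))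
    (und (product_h D h V))"
proof -
  have asym: "asym (parcs D)" and U: "und D = unicyclic ts"
    using orientation by (auto simp: orientation_of_def)
  have "fold (\<lambda>(a, b) p. transport D h a b \<circ> p) (cycle_arcs ts) id = composed_perm h (cycle_arcs ts)"
    unfolding composed_perm_def
    using cycle by (intro fold_cong) (auto simp: transport_def)
  with dec have dec': "cycle_decomposition_of V
      (fold (\<lambda>(a, b) p. transport D h a b \<circ> p) (cycle_arcs ts) id) \<sigma>"
    by simp
  have "und (product_h D h V) = voltage_cover (unicyclic ts) V (transport D h)"
    unfolding U[symmetric] using asym h by (rule und_product_eq_voltage_cover)
  then show ?thesis
  proof (simp only:, intro unicyclic_cover[OF _ \<open>ts \<noteq> []\<close> _ _ dec'])
    fix a b
    assume ab: "(a, b) \<in> parcs (unicyclic ts)"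
    show "transport D h a b permutes V"
      by (rule transport_permutes[OF asym h]) (simp_all add: U ab)
    show "transport D h b a (transport D h a b x) = x" for x
      by (rule transport_transport[OF asym h]) (simp_all add: U ab)
  qed (use trees in auto)
qed

theorem theorem3p3:
  fixes l :: nat
    and Ts :: "nat \<Rightarrow> 'a rooted_tree list"
    and G :: "(nat \<times> nat \<times> 'a) pair_pre_digraph"
    and Di :: "nat \<Rightarrow> (nat \<times> 'a) pair_pre_digraph"
    and D :: "(nat \<times> nat \<times> 'a) pair_pre_digraph"
    and \<Gamma> :: "'v pair_pre_digraph set"
    and V :: "'v set"
    and h :: "(nat \<times> nat \<times> 'a) \<times> (nat \<times> nat \<times> 'a) \<Rightarrow> 'v pair_pre_digraph"
    and P :: "nat \<Rightarrow> 'v \<Rightarrow> 'v"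
    and \<sigma> :: "nat \<Rightarrow> 'v list list"
  assumes trees: "\<And>i T w. i < l \<Longrightarrow> (T, w) \<in> set (Ts i) \<Longrightarrow> tree_graph T \<and> w \<in> pverts T"
    and cycle_length: "\<And>i. i < l \<Longrightarrow> 3 \<le> length (Ts i)"
    and G_def: "G = disjoint_sum {..<l} (\<lambda>i. unicyclic (Ts i))"
    and G_simple: "pair_graph G"
    and orientation: "\<And>i. i < l \<Longrightarrow> orientation_of (Di i) (unicyclic (Ts i))"
    and strong_cycle: "\<And>i. i < l \<Longrightarrow> set (cycle_arcs (Ts i)) \<subseteq> parcs (Di i)"
    and D_def: "D = disjoint_sum {..<l} Di"
    and Gamma: "\<And>F. F \<in> \<Gamma> \<Longrightarrow> one_regular F \<and> pverts F = V"
    and h: "h \<in> parcs D \<rightarrow> \<Gamma>"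
    and P_def: "\<And>i. i < l \<Longrightarrow>
      P i = composed_perm h (map (\<lambda>(u, v). ((i, u), (i, v))) (cycle_arcs (Ts i)))"
    and decomposition: "\<And>i. i < l \<Longrightarrow> cycle_decomposition_of V (P i) (\<sigma> i)"
  shows "und (product_h D h V) \<cong>\<^sub>g
    disjoint_sum {..<l} (\<lambda>i. disjoint_sum {..<length (\<sigma> i)} (\<lambda>j.
      unicyclic_power (Ts i) (length (\<sigma> i ! j))))"
proof -
  define H where "H i = disjoint_sum {..<length (\<sigma> i)}
    (\<lambda>j. unicyclic_power (Ts i) (length (\<sigma> i ! j)))" for i
  \<comment> \<open>The labelling of component \<open>i\<close> with the tag \<open>i\<close>
    stripped from the vertices, as \<open>Di i\<close> carries no tags.\<close>
  define hi where "hi i = (\<lambda>(u, v). h ((i, u), (i, v)))" for i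
  have "\<exists>f. iso_map f (H i) (und (product_h (Di i) (hi i) V))" if i: "i < l" for i
    unfolding H_def
  proof (rule iso_map_unicyclic_product)
    show "Ts i \<noteq> []" using cycle_length[OF i] by auto
    show "one_regular (hi i e) \<and> pverts (hi i e) = V" if "e \<in> parcs (Di i)" for e
    proof -
      have "((i, fst e), (i, snd e)) \<in> parcs D"
        using i that by (cases e) (auto simp: D_def parcs_disjoint_sum)
      then show ?thesis
        using h Gamma by (auto simp: hi_def case_prod_beta)
    qed
    have "P i = composed_perm (hi i) (cycle_arcs (Ts i))"
      by (simp add: P_def[OF i] composed_perm_def fold_map comp_def hi_def case_prod_beta)
    then show "cycle_decomposition_of V (composed_perm (hi i) (cycle_arcs (Ts i))) (\<sigma> i)"
      using decomposition[OF i] by simp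
  qed (use trees orientation strong_cycle i in auto)
  then obtain f where f: "\<And>i. i < l \<Longrightarrow> iso_map (f i) (H i) (und (product_h (Di i) (hi i) V))"
    by metis
  let ?f = "\<lambda>(i, x). ((i, fst (f i x)), snd (f i x))"
  have iso: "iso_map ?f (disjoint_sum {..<l} H) (und (product_h D h V))"
    unfolding D_def by (rule iso_map_disjoint_sum_product) (use f hi_def in auto)
  \<comment> \<open>Well-formedness of the sum permits inverting \<open>iso\<close>, and through
    \<open>iso_map_wf\<close> it also yields that of the product.\<close>
  have "pair_wf_digraph (disjoint_sum {..<l} H)"
    unfolding H_def unicyclic_power_def
  proof (intro disjoint_sum_wf unicyclic_wf)
    fix i j T w
    assume "i \<in> {..<l}" "(T, w) \<in> set (concat (replicate (length (\<sigma> i ! j)) (Ts i)))"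
    then show "pair_wf_digraph T \<and> w \<in> pverts T"
      using trees tree_graph_wf by (auto simp: in_set_replicate)
  qed
  then show ?thesis
    using iso iso_map_inverse iso_map_wf iso_map_imp_graph_iso unfolding H_def by blast
qed

end
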